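(* Let $p\ge 1$ be an integer and suppose that the integrator $\Phi_h$ is of order $p$; more precisely, suppose that for smooth vector fields $f$ on $\mathbb{R}^n$, $$\Phi_h(f,y)=\phi_h(f,y)+h^{p+1}\delta_{p+1}(f,y)+O(h^{p+2}),$$ where $\phi_h(f,\cdot)$ denotes the exact time-$h$ flow of $\dot y=f(y)$ and $h^{p+1}\delta_{p+1}(f,y)$ is the leading term of the local truncation error. Then, for a smooth vector field $f$ on $\mathbb{R}^n$, the inverse modified equation of $\dot y=f(y)$ with respect to $\Phi_h$ satisfies $$\dot{\tilde y}=f_h(\tilde y)=f(\tilde y)+h^{p}f_{p+1}(\tilde y)+\cdots,\qquad f_{p+1}(y)=-\delta_{p+1}(f,y),$$ as an identity of formal power series in $h$. That is, its coefficients $f_1,f_2,\dots$ satisfy $f_1=f$, $f_j=0$ for $2\le j\le p$, and $f_{p+1}(y)=-\delta_{p+1}(f,y)$.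
   Context: All statements are at the level of formal power series in the step size $h$ (no convergence is claimed); orders $O(h^k)$ are understood as statements about the coefficients of these expansions. Exact flow. For a smooth vector field $f:\mathbb{R}^n\to\mathbb{R}^n$, $\phi_h(f,y)$ is the time-$h$ flow of $\dot y=f(y)$ started at $y$. It is identified with its Taylor expansion $$\phi_h(f,y)=y+hf(y)+\tfrac{h^2}{2}f'(y)f(y)+\tfrac{h^3}{6}\big(f''(f,f)(y)+f'f'f(y)\big)+\cdots .$$ Integrator. A (one-step) numerical integrator $\Phi_h$ assigns to each smooth vector field $g$ a one-step map $y\mapsto\Phi_h(g,y)$ with an expansion $$\Phi_h(g,y)=y+h\,d_1(g,y)+h^2d_2(g,y)+h^3d_3(g,y)+\cdots.$$ Here each $d_j(g,\cdot)$ is a given expression, the same for all $g$, composed of $g$ and its derivatives (a polynomial expression in the components of $g$ and their partial derivatives, evaluated at $y$). Hence a formal power series $g=\sum_{k\ge1}h^{k-1}g_k$ of smooth vector fields may be substituted for $g$ and the result re-expanded in powers of $h$. Inverse modified equation. Given $f$ and $\Phi_h$, the inverse modified equation is $\dot{\tilde y}=f_h(\tilde y)$, where $$f_h(y)=f_1(y)+hf_2(y)+h^2f_3(y)+\cdots$$ is the formal power series whose $h$-independent smooth coefficients $f_j$ are determined recursively by requiring $$\Phi_h(f_h,y)=\phi_h(f,y)$$ as formal power series in $h$, comparing like powers of $h$. (Thus the integrator applied to $f_h$ reproduces the exact solution of $\dot y=f(y)$ at the grid points.) *)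

theory Defs
  imports "HOL-Analysis.Analysis"
begin

section \<open>Smooth vector fields\<close>

definition partial_deriv :: "'n \<Rightarrow> (real ^ 'n \<Rightarrow> real) \<Rightarrow> real ^ 'n \<Rightarrow> real"
  where "partial_deriv i u = (\<lambda>y. frechet_derivative u (at y) (axis i 1))"

definition iter_partial :: "'n list \<Rightarrow> (real ^ 'n \<Rightarrow> real) \<Rightarrow> real ^ 'n \<Rightarrow> real"
  where "iter_partial \<alpha> u = foldr partial_deriv \<alpha> u"

text \<open>
  Requiring every iterated partial derivative to be (Frechet) differentiable everywhere makes
  all of them continuous, so this is \<open>C\<^sup>\<infinity>\<close>.
\<close>

definition smooth_fun :: "(real ^ 'n \<Rightarrow> real) \<Rightarrow> bool"
  where "smooth_fun u \<longleftrightarrow> (\<forall>\<alpha> y. iter_partial \<alpha> u differentiable (at y))"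

definition smooth_field :: "(real ^ 'n \<Rightarrow> real ^ 'n) \<Rightarrow> bool"
  where "smooth_field g \<longleftrightarrow> (\<forall>i. smooth_fun (\<lambda>y. g y $ i))"


section \<open>The exact flow and its Taylor series\<close>

text \<open>
  A smooth field need not be complete, so the flow through \<open>y\<close> is only pinned down for times
  near 0; only its derivatives at time 0 are used.
\<close>

definition local_solution ::
    "(real ^ 'n \<Rightarrow> real ^ 'n) \<Rightarrow> real ^ 'n \<Rightarrow> (real \<Rightarrow> real ^ 'n) \<Rightarrow> bool"
  where "local_solution f y x \<longleftrightarrow>
    x 0 = y \<and> (\<forall>\<^sub>F t in nhds 0. (x has_vector_derivative f (x t)) (at t))"

definition exact_flow :: "(real ^ 'n \<Rightarrow> real ^ 'n) \<Rightarrow> real ^ 'n \<Rightarrow> real \<Rightarrow> real ^ 'n"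
  where "exact_flow f y = (SOME x. local_solution f y x)"

text \<open>
  Formal power series in \<open>h\<close> with values in \<open>\<real>\<^sup>n\<close> are elements of \<open>(real fps) ^ 'n\<close>; the
  indeterminate is \<open>fps_X\<close>.
\<close>

definition flow_series :: "(real ^ 'n \<Rightarrow> real ^ 'n) \<Rightarrow> real ^ 'n \<Rightarrow> (real fps) ^ 'n"
  where "flow_series f y =
    (\<chi> i. Abs_fps (\<lambda>k. (deriv ^^ k) (\<lambda>t. exact_flow f y t $ i) 0 / fact k))"


section \<open>Differential polynomials and integrators\<close>

text \<open>
  Polynomial expressions in the components of an unspecified vector field \<open>g\<close> and their partial
  derivatives: \<open>DP_Deriv i \<alpha>\<close> stands for \<open>\<partial>\<^sub>\<alpha> g\<^sub>i\<close>, so \<open>DP_Deriv i []\<close> is \<open>g\<^sub>i\<close> itself.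
\<close>

datatype 'n diff_poly =
    DP_Const real
  | DP_Deriv 'n "'n list"
  | DP_Add "'n diff_poly" "'n diff_poly"
  | DP_Mult "'n diff_poly" "'n diff_poly"

primrec dp_eval ::
    "(real \<Rightarrow> 'a::comm_ring_1) \<Rightarrow> ('n \<Rightarrow> 'n list \<Rightarrow> 'a) \<Rightarrow> 'n diff_poly \<Rightarrow> 'a" where
  "dp_eval c v (DP_Const r) = c r"
| "dp_eval c v (DP_Deriv i \<alpha>) = v i \<alpha>"
| "dp_eval c v (DP_Add P Q) = dp_eval c v P + dp_eval c v Q"
| "dp_eval c v (DP_Mult P Q) = dp_eval c v P * dp_eval c v Q"

definition dp_value :: "'n diff_poly \<Rightarrow> (real ^ 'n \<Rightarrow> real ^ 'n) \<Rightarrow> real ^ 'n \<Rightarrow> real"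
  where "dp_value P g y = dp_eval (\<lambda>r. r) (\<lambda>i \<alpha>. iter_partial \<alpha> (\<lambda>z. g z $ i) y) P"

text \<open>
  A sequence \<open>G\<close> of vector fields encodes the formal vector field \<open>\<Sum>k\<ge>1. h^(k-1) * G k\<close>; the
  entry \<open>G 0\<close> is not used. Partial derivatives of the formal field are taken coefficientwise.
\<close>

definition dp_subst ::
    "'n diff_poly \<Rightarrow> (nat \<Rightarrow> real ^ 'n \<Rightarrow> real ^ 'n) \<Rightarrow> real ^ 'n \<Rightarrow> real fps"
  where "dp_subst P G y =
    dp_eval fps_const (\<lambda>i \<alpha>. Abs_fps (\<lambda>k. iter_partial \<alpha> (\<lambda>z. G (Suc k) z $ i) y)) P"

text \<open>
  An integrator is given by its expansion: \<open>d j i\<close>, for \<open>j \<ge> 1\<close>, is the \<open>i\<close>-th component of the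
  expression \<open>d\<^sub>j\<close> (the entry \<open>d 0\<close> is not used).
\<close>

type_synonym 'n integrator = "nat \<Rightarrow> 'n \<Rightarrow> 'n diff_poly"

definition integrator_series ::
    "'n integrator \<Rightarrow> (real ^ 'n \<Rightarrow> real ^ 'n) \<Rightarrow> real ^ 'n \<Rightarrow> (real fps) ^ 'n"
  where "integrator_series d g y =
    (\<chi> i. Abs_fps (\<lambda>k. if k = 0 then y $ i else dp_value (d k i) g y))"

text \<open>
  For a formal vector field, each \<open>d\<^sub>j\<close> contributes a whole power series, and the coefficient of
  \<open>h^k\<close> in \<open>y + (\<Sum>j\<ge>1. h^j * d\<^sub>j(G, y))\<close> collects those of \<open>h^(k-j)\<close> in \<open>d\<^sub>j(G, y)\<close>.
\<close>

definition integrator_series_formal ::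
    "'n integrator \<Rightarrow> (nat \<Rightarrow> real ^ 'n \<Rightarrow> real ^ 'n) \<Rightarrow> real ^ 'n \<Rightarrow> (real fps) ^ 'n"
  where "integrator_series_formal d G y =
    (\<chi> i. Abs_fps (\<lambda>k. if k = 0 then y $ i
                       else (\<Sum>j = 1..k. fps_nth (dp_subst (d j i) G y) (k - j))))"

lemma iter_partial_zero: "iter_partial \<alpha> (\<lambda>_. 0) = (\<lambda>_. 0)"
  by (induction \<alpha>) (simp_all add: iter_partial_def partial_deriv_def)

lemma dp_subst_constant:
  "dp_subst P (\<lambda>k. if k = 1 then g else (\<lambda>_. 0)) y = fps_const (dp_value P g y)"
proof (induction P)
  case (DP_Deriv i \<alpha>)
  show ?case
    by (rule fps_ext)
       (auto simp: dp_subst_def dp_value_def iter_partial_zero)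
qed (auto simp: dp_subst_def dp_value_def)

lemma integrator_series_formal_constant:
  "integrator_series_formal d (\<lambda>k. if k = 1 then g else (\<lambda>_. 0)) y = integrator_series d g y"
proof -
  have "(\<Sum>j = 1..k. fps_nth (fps_const (dp_value (d j i) g y)) (k - j)) = dp_value (d k i) g y"
    if "k \<noteq> 0" for k i
  proof -
    have "(\<Sum>j = 1..k. fps_nth (fps_const (dp_value (d j i) g y)) (k - j))
        = (\<Sum>j = 1..k. if j = k then dp_value (d j i) g y else 0)"
      by (intro sum.cong) auto
    then show ?thesis
      using that by simp
  qed
  then show ?thesis
    unfolding integrator_series_formal_def integrator_series_def dp_subst_constant
    by (auto simp: vec_eq_iff fps_eq_iff)
qed


section \<open>Order and inverse modified equation\<close>

text \<open>The last summand is the \<open>O(h\<^bsup>p+2\<^esup>)\<close> remainder.\<close>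

definition order_with_error ::
    "'n integrator \<Rightarrow> nat \<Rightarrow> ((real ^ 'n \<Rightarrow> real ^ 'n) \<Rightarrow> real ^ 'n \<Rightarrow> real ^ 'n) \<Rightarrow> bool"
  where "order_with_error d p \<delta> \<longleftrightarrow>
    (\<forall>g y. smooth_field g \<longrightarrow>
      (\<exists>R. \<forall>i. integrator_series d g y $ i =
        flow_series g y $ i + fps_X ^ (p + 1) * fps_const (\<delta> g y $ i) + fps_X ^ (p + 2) * R i))"

definition inverse_modified_equation ::
    "'n integrator \<Rightarrow> (real ^ 'n \<Rightarrow> real ^ 'n) \<Rightarrow> (nat \<Rightarrow> real ^ 'n \<Rightarrow> real ^ 'n) \<Rightarrow> bool"
  where "inverse_modified_equation d f F \<longleftrightarrow>
    (\<forall>j\<ge>1. smooth_field (F j)) \<and> (\<forall>y. integrator_series_formal d F y = flow_series f y)"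

end

theory Submission
  imports Defs
begin

text \<open>
  Comparing coefficients of \<open>h\<close> in the order condition gives \<open>d\<^sub>1(g, y) = g(y)\<close> for every smooth
  field \<open>g\<close>; only here is a property of the flow used, namely that a local solution exists.
  If \<open>f\<^sub>1 = f\<close> and \<open>f\<^sub>2 = \<dots> = f\<^sub>m = 0\<close>, then the coefficient of \<open>h\<^bsup>m+1\<^esup>\<close> in
  \<open>\<Phi>\<^sub>h(f\<^sub>h, y)\<close> is \<open>d\<^bsub>m+1\<^esub>(f, y)\<close> plus the derivative of
  \<open>\<epsilon> \<mapsto> d\<^sub>1(f + \<epsilon> f\<^bsub>m+1\<^esub>, y)\<close> at 0, and the latter is \<open>f\<^bsub>m+1\<^esub>(y)\<close>. Comparison with the
  order condition therefore yields 0 for \<open>m < p\<close> and \<open>-\<delta>\<^bsub>p+1\<^esub>\<close> for \<open>m = p\<close>.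
\<close>

section \<open>Local existence of solutions\<close>

text \<open>Picard iteration: for small \<open>a\<close> the integral operator is a contraction on
  bounded continuous functions. The bound on \<open>x t - y\<close> is kept in the conclusion
  because it later confines the solution to a ball.\<close>

lemma global_lipschitz_solution:
  fixes g :: "'a::banach \<Rightarrow> 'a"
  assumes lip: "\<And>u v. norm (g u - g v) \<le> L * norm (u - v)"
    and bound: "\<And>u. norm (g u) \<le> M"
    and a: "a > 0" and small: "6 * a * L \<le> 1"
  shows "\<exists>x. x 0 = y \<and> (\<forall>t\<in>{-a<..<a}. (x has_vector_derivative g (x t)) (at t))
    \<and> (\<forall>t. norm (x t - y) \<le> 3 * a * M)"
proof -
  have cont_g: "continuous_on UNIV g"
  proof -
    \<comment> \<open>The sign of \<open>L\<close> is not assumed, whereas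
      \<open>lipschitz_on\<close> asks for a nonnegative constant.\<close>
    have "(max L 0)-lipschitz_on UNIV g"
    proof (rule lipschitz_onI)
      fix u v :: 'a
      have "L * norm (u - v) \<le> max L 0 * norm (u - v)"
        by (intro mult_right_mono) auto
      with lip[of u v] show "dist (g u) (g v) \<le> max L 0 * dist u v"
        by (simp add: dist_norm)
    qed auto
    then show ?thesis
      by (rule lipschitz_on_continuous_on)
  qed
  \<comment> \<open>Clamping time to \<open>{-a..a}\<close> makes every iterate a bounded function
    on the whole line, so the fixed point theorem applies to the complete type
    \<open>real \<Rightarrow>\<^sub>C 'a\<close>.\<close>
  define c where "c t = max (- a) (min a t)" for t :: real
  have c: "c t \<in> {-a..a}" for t
    using a by (auto simp: c_def)
  have c_id: "c t = t" if "t \<in> {-a..a}" for t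
    using that by (auto simp: c_def)
  have cont_c: "continuous_on UNIV c"
    unfolding c_def by (intro continuous_intros)
  \<comment> \<open>This is the oriented integral from 0 to \<open>c t\<close>. Integrating over
    \<open>{0..c t}\<close> would give 0 for negative times, hence the base point
    \<open>-a\<close>.\<close>
  define T where "T x t = y + (integral {-a..c t} (\<lambda>s. g (x s)) - integral {-a..0} (\<lambda>s. g (x s)))"
    for x t
  \<comment> \<open>The intervals have lengths at most \<open>2 * a\<close> and \<open>a\<close>,
    whence the factor 3; \<open>6 * a * L \<le> 1\<close> then gives the contraction factor
    1/2.\<close>
  have gap: "norm (integral {-a..c t} u - integral {-a..0} u) \<le> 3 * a * B"
    if u: "continuous_on UNIV u" and B: "\<And>s. norm (u s) \<le> B" for u :: "real \<Rightarrow> 'a" and B t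
  proof -
    have B0: "B \<ge> 0"
      using B[of 0] norm_ge_zero order_trans by blast
    have "norm (integral {-a..c t} u) \<le> B * (c t - - a)"
      using c[of t] by (intro integral_bound continuous_on_subset[OF u] B) auto
    also have "\<dots> \<le> B * (2 * a)"
      using c[of t] by (intro mult_left_mono B0) auto
    finally have 1: "norm (integral {-a..c t} u) \<le> B * (2 * a)" .
    have "norm (integral {-a..0} u) \<le> B * (0 - - a)"
      using a by (intro integral_bound continuous_on_subset[OF u] B) auto
    with 1 norm_triangle_ineq4[of "integral {-a..c t} u" "integral {-a..0} u"] show ?thesis
      by (simp add: algebra_simps)
  qed
  have cont_comp: "continuous_on UNIV (\<lambda>s. g (apply_bcontfun x s))" for x :: "real \<Rightarrow>\<^sub>C 'a"
    by (intro continuous_on_compose2[OF cont_g] continuous_on_apply_bcontfun) auto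
  have dev: "norm (T (apply_bcontfun x) t - y) \<le> 3 * a * M" for x t
    using gap[OF cont_comp bound] by (simp add: T_def)
  have bcont: "T (apply_bcontfun x) \<in> bcontfun" for x
  proof (rule bcontfun_normI)
    have "continuous_on {-a..a} (\<lambda>t. integral {-a..t} (\<lambda>s. g (apply_bcontfun x s)))"
      by (intro indefinite_integral_continuous_1 integrable_continuous_interval
          continuous_on_subset[OF cont_comp]) auto
    then have "continuous_on UNIV (\<lambda>t. integral {-a..c t} (\<lambda>s. g (apply_bcontfun x s)))"
      by (rule continuous_on_compose2[OF _ cont_c]) (use c in auto)
    then show "continuous_on UNIV (T (apply_bcontfun x))"
      unfolding T_def by (intro continuous_intros)
    show "norm (T (apply_bcontfun x) t) \<le> norm y + 3 * a * M" for t
      using dev[of x t] norm_triangle_sub[of "T (apply_bcontfun x) t" y] by simp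
  qed
  define S where "S x = Bcontfun (T (apply_bcontfun x))" for x
  have S: "apply_bcontfun (S x) = T (apply_bcontfun x)" for x
    by (simp add: S_def Bcontfun_inverse bcont)
  have "\<exists>!x. S x = x"
  proof (rule banach_fix_type[where c = "1/2"])
    show "\<forall>x z. dist (S x) (S z) \<le> 1/2 * dist x z"
    proof (intro allI dist_bound)
      fix x z :: "real \<Rightarrow>\<^sub>C 'a" and t
      let ?u = "\<lambda>s. g (apply_bcontfun x s)" and ?v = "\<lambda>s. g (apply_bcontfun z s)"
      have int: "?u integrable_on {-a..b}" "?v integrable_on {-a..b}" for b
        by (intro integrable_continuous_interval continuous_on_subset[OF cont_comp]; simp)+
      have "T (apply_bcontfun x) t - T (apply_bcontfun z) t
          = integral {-a..c t} (\<lambda>s. ?u s - ?v s) - integral {-a..0} (\<lambda>s. ?u s - ?v s)"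
        by (simp add: T_def integral_diff int)
      also have "norm \<dots> \<le> 3 * a * (max L 0 * dist x z)"
      proof (rule gap)
        show "continuous_on UNIV (\<lambda>s. ?u s - ?v s)"
          by (intro continuous_intros cont_comp)
        fix s
        have "norm (?u s - ?v s) \<le> L * dist (apply_bcontfun x s) (apply_bcontfun z s)"
          using lip by (simp add: dist_norm)
        also have "\<dots> \<le> max L 0 * dist x z"
          by (intro mult_mono dist_bounded) auto
        finally show "norm (?u s - ?v s) \<le> max L 0 * dist x z" .
      qed
      also have "\<dots> = 3 * a * max L 0 * dist x z"
        by simp
      also have "\<dots> \<le> 1/2 * dist x z"
        using small a by (intro mult_right_mono) (auto simp: max_def)
      finally show "dist (apply_bcontfun (S x) t) (apply_bcontfun (S z) t) \<le> 1/2 * dist x z"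
        by (simp add: dist_norm S)
    qed
  qed auto
  then obtain X where "S X = X"
    by auto
  define x where "x = apply_bcontfun X"
  have x: "x t = T x t" for t
    using S[of X] unfolding \<open>S X = X\<close> x_def by (rule fun_cong)
  have "(x has_vector_derivative g (x t)) (at t)" if t: "t \<in> {-a<..<a}" for t
  proof -
    have "((\<lambda>t. integral {-a..t} (\<lambda>s. g (x s))) has_vector_derivative g (x t))
        (at t within {-a..a})"
      using t unfolding x_def
      by (intro integral_has_vector_derivative continuous_on_subset[OF cont_comp]) auto
    then have "((\<lambda>t. integral {-a..t} (\<lambda>s. g (x s))) has_vector_derivative g (x t)) (at t)"
      using t at_within_interior[of t "{-a..a}"] by simp
    then have "((\<lambda>t. y + (integral {-a..t} (\<lambda>s. g (x s)) - integral {-a..0} (\<lambda>s. g (x s))))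
        has_vector_derivative g (x t)) (at t)"
      by (auto intro!: derivative_eq_intros)
    moreover have "y + (integral {-a..s} (\<lambda>s. g (x s)) - integral {-a..0} (\<lambda>s. g (x s))) = x s"
      if "s \<in> {-a<..<a}" for s
      using x[of s] c_id[of s] that by (simp add: T_def)
    ultimately show ?thesis
      using t has_vector_derivative_transform_within_open[OF _ open_greaterThanLessThan] by blast
  qed
  moreover have "x 0 = y"
    using a x[of 0] by (simp add: T_def c_id)
  moreover have "norm (x t - y) \<le> 3 * a * M" for t
    using dev[of X t] unfolding x[of t] by (simp add: x_def)
  ultimately show ?thesis
    by blast
qed

text \<open>The nearest-point map \<open>q\<close> onto the unit ball is 1-Lipschitz, so
  \<open>f\<close> composed with \<open>q\<close> is globally Lipschitz and bounded. Its solution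
  moves by at most 1, hence stays where \<open>q\<close> is the identity and solves the original
  equation.\<close>

lemma locally_lipschitz_solution:
  fixes f :: "'a::euclidean_space \<Rightarrow> 'a"
  assumes lip: "L-lipschitz_on (cball y 1) f"
  shows "\<exists>x. x 0 = y \<and> (\<forall>\<^sub>F t in nhds 0. (x has_vector_derivative f (x t)) (at t))"
proof -
  define q where "q = closest_point (cball y 1)"
  have q: "q u \<in> cball y 1" for u
    unfolding q_def by (rule closest_point_in_set) auto
  have L: "L \<ge> 0"
    using lip by (rule lipschitz_on_nonneg)
  \<comment> \<open>\<open>M\<close> bounds \<open>f\<close> on the unit ball. The choice of
    \<open>a\<close> meets both \<open>6 * a * L \<le> 1\<close> and
    \<open>3 * a * M \<le> 1\<close>, the summand 1 keeping the denominator positive.\<close>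
  define M where "M = norm (f y) + L"
  define a where "a = 1 / (6 * (M + L + 1))"
  have M: "M \<ge> 0"
    using L by (simp add: M_def)
  then have a: "a > 0" "6 * a * L \<le> 1" "3 * a * M \<le> 1"
    using L by (auto simp: a_def field_simps)
  have lip_q: "norm (f (q u) - f (q v)) \<le> L * norm (u - v)" for u v
  proof -
    have "norm (f (q u) - f (q v)) \<le> L * dist (q u) (q v)"
      using lipschitz_onD[OF lip q q] by (simp add: dist_norm)
    also have "\<dots> \<le> L * dist u v"
      unfolding q_def by (intro mult_left_mono closest_point_lipschitz L) auto
    finally show ?thesis
      by (simp add: dist_norm)
  qed
  have bound_q: "norm (f (q u)) \<le> M" for u
  proof -
    have "norm (f (q u) - f y) \<le> L * dist (q u) y"
      using lipschitz_onD[OF lip q] by (simp add: dist_norm)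
    also have "\<dots> \<le> L * 1"
      using q[of u] by (intro mult_left_mono L) (auto simp: dist_commute)
    finally show ?thesis
      using norm_triangle_sub[of "f (q u)" "f y"] by (simp add: M_def)
  qed
  obtain x where x: "x 0 = y" "\<And>t. norm (x t - y) \<le> 3 * a * M"
    and deriv: "\<And>t. t \<in> {-a<..<a} \<Longrightarrow> (x has_vector_derivative f (q (x t))) (at t)"
    using global_lipschitz_solution[OF lip_q bound_q a(1,2), of y] by blast
  have "q (x t) = x t" for t
    unfolding q_def using x(2)[of t] a
    by (intro closest_point_self) (auto simp: dist_norm norm_minus_commute)
  with deriv have sol: "\<And>t. t \<in> {-a<..<a} \<Longrightarrow> (x has_vector_derivative f (x t)) (at t)"
    by simp
  have "\<forall>\<^sub>F t in nhds 0. t \<in> {-a<..<a}"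
    using a by (intro eventually_nhds_in_open) auto
  then have "\<forall>\<^sub>F t in nhds 0. (x has_vector_derivative f (x t)) (at t)"
    by (rule eventually_mono) (rule sol)
  with x(1) show ?thesis
    by blast
qed

text \<open>The first partials are differentiable, hence continuous and bounded on the compact ball;
  they bound the operator norm of the derivative, and the mean value inequality applies because the
  ball is convex.\<close>

lemma smooth_fun_lipschitz:
  fixes u :: "real ^ 'n \<Rightarrow> real"
  assumes "smooth_fun u"
  shows "\<exists>L. L-lipschitz_on (cball y r) u"
proof -
  have der: "(u has_derivative frechet_derivative u (at z)) (at z)" for z
    using assms[unfolded smooth_fun_def, rule_format, of "[]" z]
    by (simp add: iter_partial_def frechet_derivative_works)
  have "\<exists>B. \<forall>z\<in>cball y r. norm (partial_deriv j u z) \<le> B" for j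
  proof -
    have "partial_deriv j u differentiable (at z)" for z
      using assms[unfolded smooth_fun_def, rule_format, of "[j]" z] by (simp add: iter_partial_def)
    then have "continuous_on (cball y r) (partial_deriv j u)"
      by (simp add: continuous_at_imp_continuous_on differentiable_imp_continuous_within)
    then have "bounded (partial_deriv j u ` cball y r)"
      by (intro compact_imp_bounded compact_continuous_image) auto
    then show ?thesis
      by (auto simp: bounded_iff)
  qed
  then obtain B where B: "\<And>j z. z \<in> cball y r \<Longrightarrow> norm (partial_deriv j u z) \<le> B j"
    by metis
  have "onorm (frechet_derivative u (at z)) \<le> (\<Sum>j\<in>UNIV. \<bar>B j\<bar>)" if z: "z \<in> cball y r" for z
  proof (rule onorm_bound)
    fix h :: "real ^ 'n"
    interpret bounded_linear "frechet_derivative u (at z)"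
      using der by (rule has_derivative_bounded_linear)
    have "frechet_derivative u (at z) h
        = frechet_derivative u (at z) (\<Sum>j\<in>UNIV. (h $ j) *\<^sub>R axis j 1)"
      using basis_expansion[of h] by (simp add: scalar_mult_eq_scaleR)
    also have "\<dots> = (\<Sum>j\<in>UNIV. h $ j * partial_deriv j u z)"
      by (simp add: sum scale partial_deriv_def)
    also have "norm \<dots> \<le> (\<Sum>j\<in>UNIV. norm h * \<bar>B j\<bar>)"
    proof (intro sum_norm_le)
      fix j
      have "norm (partial_deriv j u z) \<le> \<bar>B j\<bar>"
        using B[OF z, of j] by linarith
      then show "norm (h $ j * partial_deriv j u z) \<le> norm h * \<bar>B j\<bar>"
        by (simp add: abs_mult mult_mono component_le_norm_cart)
    qed
    finally show "norm (frechet_derivative u (at z) h) \<le> (\<Sum>j\<in>UNIV. \<bar>B j\<bar>) * norm h"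
      by (simp add: sum_distrib_left mult.commute)
  qed (simp add: sum_nonneg)
  then have "norm (u v - u w) \<le> (\<Sum>j\<in>UNIV. \<bar>B j\<bar>) * norm (v - w)"
    if "v \<in> cball y r" "w \<in> cball y r" for v w
    using that der
    by (intro differentiable_bound[of "cball y r"]) (auto intro: has_derivative_at_withinI)
  then have "(\<Sum>j\<in>UNIV. \<bar>B j\<bar>)-lipschitz_on (cball y r) u"
    by (intro lipschitz_onI) (auto simp: dist_norm sum_nonneg)
  then show ?thesis ..
qed

section \<open>Local solutions for smooth fields and the linear coefficient of the flow\<close>

lemma smooth_field_local_solution:
  fixes f :: "real ^ 'n \<Rightarrow> real ^ 'n"
  assumes "smooth_field f"
  shows "\<exists>x. local_solution f y x"
proof -
  have "\<exists>L. L-lipschitz_on (cball y 1) (\<lambda>z. f z $ i)" for i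
    using assms by (intro smooth_fun_lipschitz) (simp add: smooth_field_def)
  then obtain L where L: "\<And>i. (L i)-lipschitz_on (cball y 1) (\<lambda>z. f z $ i)"
    by metis
  have "(\<Sum>i\<in>UNIV. L i)-lipschitz_on (cball y 1) f"
  proof (rule lipschitz_onI)
    fix u v assume uv: "u \<in> cball y 1" "v \<in> cball y 1"
    have "dist (f u) (f v) \<le> (\<Sum>i\<in>UNIV. \<bar>(f u - f v) $ i\<bar>)"
      unfolding dist_norm by (rule norm_le_l1_cart)
    also have "\<dots> \<le> (\<Sum>i\<in>UNIV. L i * dist u v)"
      using lipschitz_onD[OF L uv] by (intro sum_mono) (simp add: dist_real_def)
    finally show "dist (f u) (f v) \<le> (\<Sum>i\<in>UNIV. L i) * dist u v"
      by (simp add: sum_distrib_right)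
  qed (intro sum_nonneg lipschitz_on_nonneg[OF L])
  then show ?thesis
    unfolding local_solution_def by (rule locally_lipschitz_solution)
qed

text \<open>\<open>exact_flow\<close> is a \<open>SOME\<close> choice, so the existence of a
  solution is what makes it satisfy the equation. Since \<open>nhds 0\<close> includes 0 itself, the
  equation may be read at time 0.\<close>

lemma flow_series_nth_1:
  fixes f :: "real ^ 'n \<Rightarrow> real ^ 'n"
  assumes "smooth_field f"
  shows "fps_nth (flow_series f y $ i) 1 = f y $ i"
proof -
  have sol: "local_solution f y (exact_flow f y)"
    unfolding exact_flow_def using smooth_field_local_solution[OF assms] by (rule someI_ex)
  then have "(exact_flow f y has_vector_derivative f y) (at 0)"
    unfolding local_solution_def by (metis eventually_nhds_x_imp_x)
  then have "((\<lambda>t. exact_flow f y t $ i) has_vector_derivative f y $ i) (at 0)"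
    by (rule bounded_linear.has_vector_derivative[OF bounded_linear_vec_nth])
  then have "deriv (\<lambda>t. exact_flow f y t $ i) 0 = f y $ i"
    by (simp add: has_real_derivative_iff_has_vector_derivative DERIV_imp_deriv)
  then show ?thesis
    by (simp add: flow_series_def)
qed

section \<open>Perturbing a differential polynomial\<close>

text \<open>Modulo \<open>h^(m+1)\<close> the power \<open>h^m\<close> behaves like an infinitesimal
  of square zero, so the coefficient of \<open>h^m\<close> is a directional derivative. The three
  claims are proved together because the product case needs all of them.\<close>

lemma dp_eval_perturb:
  fixes V :: "'n \<Rightarrow> 'n list \<Rightarrow> real fps"
  assumes m: "m > 0" and gap: "\<And>i \<alpha> j. 0 < j \<Longrightarrow> j < m \<Longrightarrow> fps_nth (V i \<alpha>) j = 0"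
  shows "fps_nth (dp_eval fps_const V P) 0 = dp_eval (\<lambda>r. r) (\<lambda>i \<alpha>. fps_nth (V i \<alpha>) 0) P
    \<and> (\<forall>j. 0 < j \<and> j < m \<longrightarrow> fps_nth (dp_eval fps_const V P) j = 0)
    \<and> ((\<lambda>\<epsilon>. dp_eval (\<lambda>r. r) (\<lambda>i \<alpha>. fps_nth (V i \<alpha>) 0 + \<epsilon> * fps_nth (V i \<alpha>) m) P)
        has_field_derivative fps_nth (dp_eval fps_const V P) m) (at 0)"
proof (induction P)
  case (DP_Const r)
  then show ?case
    using m by auto
next
  case (DP_Deriv i \<alpha>)
  then show ?case
    using gap by (auto intro!: derivative_eq_intros)
next
  case (DP_Add P Q)
  then show ?case
    by (auto intro!: derivative_eq_intros)
next
  case (DP_Mult P Q)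
  define a where "a = dp_eval fps_const V P"
  define b where "b = dp_eval fps_const V Q"
  note IH = DP_Mult.IH[folded a_def b_def]
  have a: "fps_nth a k = 0" and b: "fps_nth b k = 0" if "0 < k" "k < m" for k
    using IH that by auto
  have "fps_nth (a * b) j = 0" if "0 < j" "j < m" for j
  proof -
    have "fps_nth a k * fps_nth b (j - k) = 0" if "k \<in> {0..j}" for k
      using a[of k] b[of "j - k"] that \<open>0 < j\<close> \<open>j < m\<close> by (cases "k = 0") auto
    then show ?thesis
      unfolding fps_mult_nth by (intro sum.neutral) blast
  qed
  \<comment> \<open>Only the two end terms of the Cauchy product survive, which is exactly the
    Leibniz rule.\<close>
  moreover have "fps_nth (a * b) m = fps_nth a m * fps_nth b 0 + fps_nth b m * fps_nth a 0"
  proof -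
    have "fps_nth (a * b) m = (\<Sum>k\<in>{0, m}. fps_nth a k * fps_nth b (m - k))"
      unfolding fps_mult_nth using a by (intro sum.mono_neutral_right) auto
    then show ?thesis
      using m by (simp add: algebra_simps)
  qed
  moreover have "((\<lambda>\<epsilon>. dp_eval (\<lambda>r. r) (\<lambda>i \<alpha>. fps_nth (V i \<alpha>) 0 + \<epsilon> * fps_nth (V i \<alpha>) m) P
        * dp_eval (\<lambda>r. r) (\<lambda>i \<alpha>. fps_nth (V i \<alpha>) 0 + \<epsilon> * fps_nth (V i \<alpha>) m) Q)
      has_field_derivative fps_nth a m * fps_nth b 0 + fps_nth b m * fps_nth a 0) (at 0)"
    using DERIV_mult[of _ "fps_nth a m" 0 UNIV _ "fps_nth b m"] IH by force
  ultimately show ?case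
    using IH by (simp add: a_def b_def)
qed

section \<open>Linear combinations of smooth functions and fields\<close>

lemma iter_partial_Cons: "iter_partial (a # \<alpha>) u = partial_deriv a (iter_partial \<alpha> u)"
  by (simp add: iter_partial_def)

lemma iter_partial_add_scale:
  assumes "smooth_fun u" "smooth_fun v"
  shows "iter_partial \<alpha> (\<lambda>z. u z + c * v z) = (\<lambda>z. iter_partial \<alpha> u z + c * iter_partial \<alpha> v z)"
proof (induction \<alpha>)
  case Nil
  then show ?case
    by (simp add: iter_partial_def)
next
  case (Cons a \<alpha>)
  have "frechet_derivative (\<lambda>z. iter_partial \<alpha> u z + c * iter_partial \<alpha> v z) (at z)
      = (\<lambda>h. frechet_derivative (iter_partial \<alpha> u) (at z) h
        + c * frechet_derivative (iter_partial \<alpha> v) (at z) h)" for z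
    using assms unfolding smooth_fun_def
    by (intro frechet_derivative_at[symmetric] derivative_intros)
       (simp_all flip: frechet_derivative_works)
  then show ?case
    by (simp add: iter_partial_Cons Cons.IH partial_deriv_def)
qed

lemma smooth_field_add_scale:
  assumes "smooth_field f" "smooth_field g"
  shows "smooth_field (\<lambda>z. f z + c *\<^sub>R g z)"
  unfolding smooth_field_def
proof
  fix i
  have *: "smooth_fun (\<lambda>z. f z $ i)" "smooth_fun (\<lambda>z. g z $ i)"
    using assms by (simp_all add: smooth_field_def)
  then have "iter_partial \<alpha> (\<lambda>z. f z $ i + c * g z $ i) differentiable (at y)" for \<alpha> y
    unfolding iter_partial_add_scale[OF *] smooth_fun_def
    by (intro differentiable_add differentiable_mult differentiable_const) blast+
  then show "smooth_fun (\<lambda>y. (f y + c *\<^sub>R g y) $ i)"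
    by (simp add: smooth_fun_def)
qed

section \<open>Comparison of coefficients\<close>

text \<open>The remainder starts at \<open>h^(p+2)\<close> and cannot reach these
  coefficients.\<close>

lemma integrator_series_nth:
  assumes "order_with_error d p \<delta>" "smooth_field g" "0 < k" "k \<le> p + 1"
  shows "dp_value (d k i) g y
    = fps_nth (flow_series g y $ i) k + (if k = p + 1 then \<delta> g y $ i else 0)"
proof -
  obtain R where "integrator_series d g y $ i =
      flow_series g y $ i + fps_X ^ (p + 1) * fps_const (\<delta> g y $ i) + fps_X ^ (p + 2) * R i"
    using assms unfolding order_with_error_def by metis
  then have "fps_nth (integrator_series d g y $ i) k = fps_nth (flow_series g y $ i +
      fps_X ^ (p + 1) * fps_const (\<delta> g y $ i) + fps_X ^ (p + 2) * R i) k"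
    by simp
  then show ?thesis
    using assms(3,4)
    by (auto simp: integrator_series_def fps_X_power_mult_nth simp del: power_Suc)
qed

text \<open>Consistency of the method: \<open>p \<ge> 1\<close> keeps the index 1 below
  \<open>p + 1\<close>, so no error term appears.\<close>

lemma dp_value_1:
  assumes "order_with_error d p \<delta>" "p \<ge> 1" "smooth_field g"
  shows "dp_value (d 1 i) g y = g y $ i"
  using integrator_series_nth[OF assms(1,3), of 1 i y] assms(2)
    flow_series_nth_1[OF assms(3), of y i]
  by simp

text \<open>\<open>d j\<close> enters with its coefficient of index \<open>Suc m - j\<close>. For
  \<open>j \<ge> 2\<close> this index is below \<open>m\<close>, where only constant coefficients
  are nonzero, leaving \<open>j = Suc m\<close>; only \<open>d 1\<close> sees
  \<open>F (Suc m)\<close>.\<close>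

lemma integrator_series_formal_nth:
  fixes d :: "'n::finite integrator"
  assumes ord: "order_with_error d p \<delta>" "p \<ge> 1"
    and smooth: "smooth_field (F 1)" "smooth_field (F (Suc m))"
    and m: "m > 0" and zero: "\<And>j. 2 \<le> j \<Longrightarrow> j \<le> m \<Longrightarrow> F j = (\<lambda>y. 0)"
  shows "fps_nth (integrator_series_formal d F y $ i) (Suc m)
    = F (Suc m) y $ i + dp_value (d (Suc m) i) (F 1) y"
proof -
  \<comment> \<open>By the index shift, vanishing of \<open>F 2\<close>, ..., \<open>F m\<close>
    means vanishing of the coefficients 1, ..., \<open>m - 1\<close>.\<close>
  define V where "V i \<alpha> = Abs_fps (\<lambda>k. iter_partial \<alpha> (\<lambda>z. F (Suc k) z $ i) y)" for i \<alpha>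
  have V: "fps_nth (V i \<alpha>) k = 0" if "0 < k" "k < m" for i \<alpha> k
    using that zero[of "Suc k"] by (simp add: V_def iter_partial_zero)
  have subst: "dp_subst P F y = dp_eval fps_const V P" for P
    by (simp add: dp_subst_def V_def[abs_def])
  have low: "fps_nth (dp_subst P F y) k = (if k = 0 then dp_value P (F 1) y else 0)"
    if "k < m" for P k
    using dp_eval_perturb[of m V P, OF m V] that by (simp add: subst dp_value_def V_def)
  \<comment> \<open>The expression \<open>d 1 i\<close> is known only through its values on smooth
    fields, not by its form. The perturbed field is smooth, so consistency applies for every
    \<epsilon>, and the derivative can be compared afterwards.\<close>
  have value_eq: "dp_eval (\<lambda>r. r) (\<lambda>i \<alpha>. fps_nth (V i \<alpha>) 0 + \<epsilon> * fps_nth (V i \<alpha>) m) (d 1 i)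
      = F 1 y $ i + \<epsilon> * F (Suc m) y $ i" for \<epsilon>
  proof -
    have "F 1 y $ i + \<epsilon> * F (Suc m) y $ i = dp_value (d 1 i) (\<lambda>z. F 1 z + \<epsilon> *\<^sub>R F (Suc m) z) y"
      using dp_value_1[OF ord smooth_field_add_scale[OF smooth], of i \<epsilon> y] by simp
    also have "\<dots> = dp_eval (\<lambda>r. r) (\<lambda>i \<alpha>. fps_nth (V i \<alpha>) 0 + \<epsilon> * fps_nth (V i \<alpha>) m) (d 1 i)"
      using smooth
      by (simp add: dp_value_def V_def iter_partial_add_scale smooth_field_def)
    finally show ?thesis ..
  qed
  have "((\<lambda>\<epsilon>. F 1 y $ i + \<epsilon> * F (Suc m) y $ i)
      has_field_derivative fps_nth (dp_subst (d 1 i) F y) m) (at 0)"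
    using dp_eval_perturb[of m V "d 1 i", OF m V] by (simp add: subst value_eq[simplified])
  moreover have "((\<lambda>\<epsilon>. F 1 y $ i + \<epsilon> * F (Suc m) y $ i)
      has_field_derivative F (Suc m) y $ i) (at 0)"
    by (auto intro!: derivative_eq_intros)
  ultimately have first: "fps_nth (dp_subst (d 1 i) F y) m = F (Suc m) y $ i"
    by (rule DERIV_unique)
  have "fps_nth (integrator_series_formal d F y $ i) (Suc m)
      = (\<Sum>j = 1..Suc m. fps_nth (dp_subst (d j i) F y) (Suc m - j))"
    by (simp add: integrator_series_formal_def)
  also have "\<dots> = F (Suc m) y $ i + (\<Sum>j = 2..Suc m. fps_nth (dp_subst (d j i) F y) (Suc m - j))"
    using first by (subst sum.atLeast_Suc_atMost) (simp_all add: numeral_2_eq_2)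
  also have "(\<Sum>j = 2..Suc m. fps_nth (dp_subst (d j i) F y) (Suc m - j))
      = (\<Sum>j = 2..Suc m. if j = Suc m then dp_value (d j i) (F 1) y else 0)"
    by (intro sum.cong refl) (subst low, auto)
  also have "\<dots> = dp_value (d (Suc m) i) (F 1) y"
    using m by simp
  finally show ?thesis .
qed

theorem theorem1:
  fixes d :: "'n::finite integrator"
    and p :: nat
    and \<delta> :: "(real ^ 'n \<Rightarrow> real ^ 'n) \<Rightarrow> real ^ 'n \<Rightarrow> real ^ 'n"
    and f :: "real ^ 'n \<Rightarrow> real ^ 'n"
    and F :: "nat \<Rightarrow> real ^ 'n \<Rightarrow> real ^ 'n"
  assumes "p \<ge> 1"
    and "order_with_error d p \<delta>"
    and "smooth_field f"
    and "inverse_modified_equation d f F"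
  shows "F 1 = f
    \<and> (\<forall>j. 2 \<le> j \<and> j \<le> p \<longrightarrow> F j = (\<lambda>y. 0))
    \<and> (\<forall>y. F (p + 1) y = - \<delta> f y)"
proof -
  have smooth: "smooth_field (F j)" if "j \<ge> 1" for j
    using assms(4) that by (simp add: inverse_modified_equation_def)
  have eq: "integrator_series_formal d F y = flow_series f y" for y
    using assms(4) by (simp add: inverse_modified_equation_def)
  have F1: "F 1 = f"
  proof
    fix y
    have "F 1 y $ i = f y $ i" for i
    proof -
      have "F 1 y $ i = dp_value (d 1 i) (F 1) y"
        using dp_value_1[OF assms(2,1) smooth] by simp
      \<comment> \<open>With \<open>m = 1\<close> the gap hypothesis is vacuous, and the claim about
        constant coefficients suffices.\<close>
      also have "\<dots> = fps_nth (dp_subst (d 1 i) F y) 0"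
        using dp_eval_perturb[of 1 "\<lambda>i \<alpha>. Abs_fps (\<lambda>k. iter_partial \<alpha> (\<lambda>z. F (Suc k) z $ i) y)" "d 1 i"]
        by (simp add: dp_subst_def dp_value_def)
      also have "\<dots> = fps_nth (integrator_series_formal d F y $ i) 1"
        by (simp add: integrator_series_formal_def)
      finally show ?thesis
        by (simp add: eq flow_series_nth_1[OF assms(3), simplified])
    qed
    then show "F 1 y = f y"
      by (simp add: vec_eq_iff)
  qed
  have step: "F (Suc m) y $ i = - (if m = p then \<delta> f y $ i else 0)"
    if "0 < m" "m \<le> p" "\<And>j. 2 \<le> j \<Longrightarrow> j \<le> m \<Longrightarrow> F j = (\<lambda>y. 0)" for m y i
  proof -
    have "fps_nth (flow_series f y $ i) (Suc m) = F (Suc m) y $ i + dp_value (d (Suc m) i) f y"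
      using integrator_series_formal_nth[of d p \<delta> F m y i, OF assms(2,1) smooth smooth that(1,3)]
      by (simp add: eq F1[simplified])
    \<comment> \<open>The flow coefficient is never computed: it occurs in both equations and
      cancels.\<close>
    moreover have "dp_value (d (Suc m) i) f y
        = fps_nth (flow_series f y $ i) (Suc m) + (if m = p then \<delta> f y $ i else 0)"
      using integrator_series_nth[OF assms(2,3), of "Suc m" i y] that(2) by simp
    ultimately show ?thesis
      by simp
  qed
  have zero: "2 \<le> j \<longrightarrow> j \<le> p \<longrightarrow> F j = (\<lambda>y. 0)" for j
  proof (induction j rule: less_induct)
    case (less j)
    show ?case
    proof (intro impI ext)
      fix y assume j: "2 \<le> j" "j \<le> p"
      then obtain m where m: "j = Suc m" "0 < m"
        by (cases j) auto
      \<comment> \<open>Here \<open>m < p\<close>, so the error term is absent; it enters only at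
        \<open>m = p\<close>.\<close>
      have "F j y $ i = 0" for i
        using step[of m y i] less j m by auto
      then show "F j y = 0"
        by (simp add: vec_eq_iff)
    qed
  qed
  have "F (p + 1) y $ i = - \<delta> f y $ i" for y i
    using step[of p y i] zero assms(1) by simp
  then show ?thesis
    using F1 zero by (simp add: vec_eq_iff)
qed

end
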